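(* The homeomorphism $Q_O$ of $[0,1]$ linearizes the odd Farey map $F_O$ and the odd Gauss map $T_O$ as follows: $$\text{(i)}\quad Q_O\circ F_O\circ Q_O^{-1}=\overline{F}_O,\qquad\qquad\text{(ii)}\quad Q_O\circ T_O\circ Q_O^{-1}=\overline{T}_O.$$
   Context: Odd continued fractions (OCF). Every $x\in(0,1]$ has a unique expansion $$x=[(e_1,a_1),(e_2,a_2),(e_3,a_3),\ldots]=\cfrac{e_1}{a_1+\cfrac{e_2}{a_2+\cfrac{e_3}{\ddots}}},$$ where $e_i\in\{\pm1\}$, $e_1=1$, each $a_i$ is an odd positive integer, and $a_i+e_{i+1}>0$ for all $i$; the expansion is finite if $x$ is rational and infinite if $x$ is irrational, and in a finite expansion it is required that if the last partial quotient $a_j$ equals $1$ then $e_j=1$. The number $0$ has the empty expansion. Let $\lambda>1$ be the unique real root of $x^3-x^2-x-1=0$. The function $Q_O:[0,1]\to[0,1]$ is defined by $$Q_O([(e_1,a_1),(e_2,a_2),\ldots])=-\sum_{k\ge1}\frac{(-e_1)(-e_2)\cdots(-e_k)}{\lambda^{a_1+\cdots+a_k-1}},$$ the sum being over all $k\geq 1$ for infinite expansions and over $1\le k\le n$ for finite expansions of length $n$ (so $Q_O(0)=0$). The odd Farey map $F_O:[0,1]\to[0,1]$ is $$F_O(x)=\begin{cases}\frac{x}{1-2x}&0\le x<\frac13\\ 3-\frac1x&\frac13\le x\le\frac12\\ \frac1x-1&\frac12\le x\le1.\end{cases}$$ The odd Gauss map $T_O:[0,1]\to[0,1]$ is given by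 $T_O(0)=0$ and, for $k\ge1$, $T_O(x)=2k+1-\frac1x$ if $x\in[\frac1{2k+1},\frac1{2k}]$ and $T_O(x)=\frac1x-(2k-1)$ if $x\in[\frac1{2k},\frac1{2k-1}]$. The piecewise linear maps $\overline{F}_O,\overline{T}_O:[0,1]\to[0,1]$ are $$\overline{F}_O(y)=\begin{cases}\lambda^2y&y\in[0,\lambda^{-2})\\ \lambda(\lambda^2y-1)&y\in[\lambda^{-2},1-\lambda^{-1}]\\ \lambda(1-y)&y\in[1-\lambda^{-1},1],\end{cases}$$ $$\overline{T}_O(y)=\begin{cases}\lambda-\lambda^{2k-1}y&y\in\left[\frac{\lambda-1}{\lambda^{2k-1}},\frac1{\lambda^{2k-2}}\right],\ k\ge1\\ \lambda^{2k-1}y-\lambda&y\in\left[\frac1{\lambda^{2k-2}},\frac{\lambda-1}{\lambda^{2k-3}}\right],\ k\ge2,\end{cases}\qquad \overline{T}_O(0)=0.$$ *)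

theory Defs
  imports "HOL-Analysis.Analysis"
begin

text \<open>
  A digit is a pair \<open>(e, a)\<close> of a sign and a partial quotient. Digits are indexed from 0, so
  index \<open>i\<close> here is index \<open>i + 1\<close> in the usual numbering. Finite and infinite expansions are two
  constructors of one type, so that the expansion of a number is a single well-defined object.
\<close>

datatype ocf = Fin_OCF "(int \<times> nat) list" | Inf_OCF "nat \<Rightarrow> int \<times> nat"

primrec ocf_admissible :: "ocf \<Rightarrow> bool" where
  "ocf_admissible (Fin_OCF ds) \<longleftrightarrow>
     (ds \<noteq> [] \<longrightarrow> fst (ds ! 0) = 1) \<and>
     (\<forall>i < length ds. fst (ds ! i) \<in> {1, -1} \<and> odd (snd (ds ! i))) \<and>
     (\<forall>i. Suc i < length ds \<longrightarrow> int (snd (ds ! i)) + fst (ds ! Suc i) > 0) \<and>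
     (ds \<noteq> [] \<and> snd (last ds) = 1 \<longrightarrow> fst (last ds) = 1)"
| "ocf_admissible (Inf_OCF d) \<longleftrightarrow>
     fst (d 0) = 1 \<and>
     (\<forall>i. fst (d i) \<in> {1, -1} \<and> odd (snd (d i))) \<and>
     (\<forall>i. int (snd (d i)) + fst (d (Suc i)) > 0)"

fun cf_value :: "(int \<times> nat) list \<Rightarrow> real" where
  "cf_value [] = 0"
| "cf_value ((e, a) # ds) = of_int e / (of_nat a + cf_value ds)"

text \<open>An infinite continued fraction is the limit of its truncations.\<close>

primrec ocf_represents :: "ocf \<Rightarrow> real \<Rightarrow> bool" where
  "ocf_represents (Fin_OCF ds) x \<longleftrightarrow> x = cf_value ds"
| "ocf_represents (Inf_OCF d) x \<longleftrightarrow> (\<lambda>n. cf_value (map d [0..<n])) \<longlonglongrightarrow> x"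

definition ocf_of :: "real \<Rightarrow> ocf" where
  "ocf_of x = (THE d. ocf_admissible d \<and> ocf_represents d x)"

definition lam :: real where
  "lam = (THE x. x ^ 3 - x ^ 2 - x - 1 = 0)"

text \<open>The subtraction in the exponent does not truncate, since every partial quotient is odd.\<close>

definition Q_term :: "(nat \<Rightarrow> int \<times> nat) \<Rightarrow> nat \<Rightarrow> real" where
  "Q_term d k = (\<Prod>i\<le>k. - of_int (fst (d i))) / lam ^ ((\<Sum>i\<le>k. snd (d i)) - 1)"

primrec ocf_Q :: "ocf \<Rightarrow> real" where
  "ocf_Q (Fin_OCF ds) = - (\<Sum>k<length ds. Q_term (\<lambda>i. ds ! i) k)"
| "ocf_Q (Inf_OCF d) = - (\<Sum>k. Q_term d k)"

text \<open>This and the maps below are only meaningful on \<open>{0..1}\<close>.\<close>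

definition Q_O :: "real \<Rightarrow> real" where
  "Q_O x = ocf_Q (ocf_of x)"

definition Q_O_inv :: "real \<Rightarrow> real" where
  "Q_O_inv = inv_into {0..1} Q_O"

definition F_O :: "real \<Rightarrow> real" where
  "F_O x = (if x < 1/3 then x / (1 - 2 * x)
            else if x \<le> 1/2 then 3 - 1 / x
            else 1 / x - 1)"

text \<open>
  The closed intervals in the two Gauss-type maps share endpoints, where the adjacent branches
  agree; hence the definite descriptions are well-defined on \<open>{0..1}\<close>.
\<close>

definition T_O :: "real \<Rightarrow> real" where
  "T_O x = (THE y.
     (x = 0 \<and> y = 0) \<or>
     (\<exists>k::nat. k \<ge> 1 \<and> x \<in> {1 / (2 * real k + 1) .. 1 / (2 * real k)} \<and>
        y = 2 * real k + 1 - 1 / x) \<or>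
     (\<exists>k::nat. k \<ge> 1 \<and> x \<in> {1 / (2 * real k) .. 1 / (2 * real k - 1)} \<and>
        y = 1 / x - (2 * real k - 1)))"

definition F_O_bar :: "real \<Rightarrow> real" where
  "F_O_bar y = (if y < 1 / lam ^ 2 then lam ^ 2 * y
                else if y \<le> 1 - 1 / lam then lam * (lam ^ 2 * y - 1)
                else lam * (1 - y))"

definition T_O_bar :: "real \<Rightarrow> real" where
  "T_O_bar y = (THE z.
     (y = 0 \<and> z = 0) \<or>
     (\<exists>k::nat. k \<ge> 1 \<and> y \<in> {(lam - 1) / lam ^ (2 * k - 1) .. 1 / lam ^ (2 * k - 2)} \<and>
        z = lam - lam ^ (2 * k - 1) * y) \<or>
     (\<exists>k::nat. k \<ge> 2 \<and> y \<in> {1 / lam ^ (2 * k - 2) .. (lam - 1) / lam ^ (2 * k - 3)} \<and>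
        z = lam ^ (2 * k - 1) * y - lam))"

end

theory Submission
  imports Defs
begin

text \<open>
  The idea is to keep the signs inside the remainders. For \<open>x \<noteq> 0\<close> with \<open>\<bar>x\<bar> \<le> 1\<close> there is exactly
  one way to write \<open>\<bar>x\<bar> = 1 / (a + t)\<close> with \<open>a\<close> odd and \<open>-1 < t \<le> 1\<close>. Iterating \<open>x \<mapsto> t\<close> produces
  the partial quotients \<open>a\<close>, and the signs of the iterates are the signs of the expansion. The
  admissibility conditions keep the tails of any other expansion in the same range \<open>-1 < t \<le> 1\<close>, so
  the expansion given by the orbit is the only admissible one
  (\<open>expansion_unique\<close>, \<open>ocf_of_eq_expansion\<close>). Convergence is no problem: two consecutive steps of
  the continued fraction contract by at least \<open>1/4\<close> (\<open>cf_tail_contraction\<close>), although a single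
  step with \<open>a = 1\<close> need not contract at all near \<open>0\<close>.

  The series of \<open>Q_O\<close>, summed along this orbit, makes sense for negative arguments too and gives an
  odd function \<open>odd_Q\<close>. Splitting off the first term yields its functional equation
  \<open>odd_Q (1 / (a + t)) = (lam - odd_Q t) / lam ^ a\<close> (\<open>odd_Q_inverse\<close>). The equation also holds at
  the excluded value \<open>t = -1\<close>, where it compares two consecutive odd \<open>a\<close>; there it amounts to
  \<open>lam + 1 = lam\<^sup>2 (lam - 1)\<close>, the cubic equation that defines \<open>lam\<close>.

  Everything else follows from the functional equation. A pair of points on which \<open>odd_Q\<close> fails to
  be strictly increasing must have a common first digit, and its remainders are again such a pair;
  the two points then have all digits in common and coincide (\<open>odd_Q_strict_mono\<close>). The values of
  \<open>odd_Q\<close> are dense because the branches \<open>s \<mapsto> (lam - s) / lam ^ a\<close> contract and cover the unit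
  interval (\<open>odd_Q_dense_approx\<close>), and a strictly increasing function with dense values has no jumps.
  Hence \<open>Q_O\<close> is a homeomorphism. Finally \<open>T_O\<close> maps \<open>1 / (a + t)\<close> to \<open>\<bar>t\<bar>\<close>, and \<open>T_O_bar\<close> maps
  \<open>(lam - s) / lam ^ a\<close> to \<open>\<bar>s\<bar>\<close>, so that the functional equation is the conjugacy (ii). For (i),
  \<open>F_O\<close> lowers \<open>a\<close> by \<open>2\<close> when \<open>x < 1/3\<close>, which multiplies \<open>Q_O\<close> by \<open>lam\<^sup>2\<close>, and it agrees with \<open>T_O\<close>
  elsewhere.
\<close>

section \<open>The base of the expansion\<close>

lemma cubic_root_gt_1:
  assumes "(x::real) ^ 3 - x ^ 2 - x - 1 = 0"
  shows "x > 1"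
proof (rule ccontr)
  assume "\<not> x > 1"
  \<comment> \<open>On \<open>x \<le> 1\<close> the cubic is largest at its critical point \<open>-1/3\<close>, where it is \<open>32/27 - 2 < 0\<close>.\<close>
  then have "0 \<le> (x + 1/3)\<^sup>2 * (5/3 - x)" by simp
  also have "\<dots> = 32/27 - 2 - (x ^ 3 - x ^ 2 - x - 1)"
    by (simp add: power2_eq_square power3_eq_cube field_simps)
  finally show False using assms by simp
qed

lemma cubic_root_unique:
  assumes "(x::real) ^ 3 - x ^ 2 - x - 1 = 0" and "y ^ 3 - y ^ 2 - y - 1 = 0"
  shows "x = y"
proof -
  have "(x - y) * (x * (x - 1) + y * (y - 1) + (x * y - 1)) = 0"
    using assms by (simp add: power2_eq_square power3_eq_cube algebra_simps)
  moreover have "x > 1" "y > 1" using cubic_root_gt_1 assms by auto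
  then have "x * (x - 1) > 0" "y * (y - 1) > 0" "x * y > 1"
    by (auto intro: less_1_mult)
  ultimately show ?thesis by auto
qed

lemma lam_cubic: "lam ^ 3 = lam ^ 2 + lam + 1"
proof -
  have "\<exists>x\<ge>1. x \<le> 2 \<and> x ^ 3 - x ^ 2 - x - 1 = (0::real)"
    by (rule IVT') (auto intro!: continuous_intros)
  then have "\<exists>!x. x ^ 3 - x ^ 2 - x - 1 = (0::real)"
    using cubic_root_unique by blast
  from theI'[OF this] show ?thesis unfolding lam_def by linarith
qed

lemma lam_gt_1: "lam > 1"
  using cubic_root_gt_1[of lam] lam_cubic by simp

lemma lam_pos: "lam > 0"
  using lam_gt_1 by simp

text \<open>
  The form in which the cubic equation is used: the branches of \<open>T_O_bar\<close> with parameters \<open>a\<close>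
  and \<open>a + 2\<close> meet.
\<close>

lemma lam_plus_1: "lam + 1 = lam ^ 2 * (lam - 1)"
  using lam_cubic by (simp add: algebra_simps power2_eq_square power3_eq_cube)

section \<open>Remainders and expansions\<close>

text \<open>
  This is the odd integer \<open>a\<close> with \<open>a - 1 < 1 / \<bar>x\<bar> \<le> a + 1\<close>. For even \<open>1 / \<bar>x\<bar>\<close> the choice of the
  smaller neighbour makes the remainder \<open>1\<close> rather than \<open>-1\<close>. At \<open>x = 0\<close> the truncation gives \<open>0\<close>,
  so that \<open>0\<close> is a fixed point of the remainder map.
\<close>

definition quot :: "real \<Rightarrow> nat" where
  "quot x = nat (2 * \<lceil>1 / (2 * \<bar>x\<bar>)\<rceil> - 1)"

definition rem :: "real \<Rightarrow> real" where
  "rem x = 1 / \<bar>x\<bar> - quot x"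

definition digit :: "real \<Rightarrow> int \<times> nat" where
  "digit x = ((if x < 0 then -1 else 1), quot x)"

lemma rem_0 [simp]: "rem 0 = 0"
  by (simp add: rem_def quot_def)

lemma funpow_rem_0 [simp]: "(rem ^^ n) 0 = 0"
  by (induction n) auto

lemma quot_minus [simp]: "quot (- x) = quot x"
  by (simp add: quot_def)

lemma rem_minus [simp]: "rem (- x) = rem x"
  by (simp add: rem_def)

lemma int_quot: "x \<noteq> 0 \<Longrightarrow> int (quot x) = 2 * \<lceil>1 / (2 * \<bar>x\<bar>)\<rceil> - 1"
  unfolding quot_def by (subst int_nat_eq) (auto simp: less_ceiling_iff)

lemma odd_quot: "x \<noteq> 0 \<Longrightarrow> odd (quot x)"
  using int_quot[of x] by presburger

lemma quot_ge_1: "x \<noteq> 0 \<Longrightarrow> quot x \<ge> 1"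
  using odd_quot[of x] by (cases "quot x") auto

lemma rem_bounds: "-1 < rem x" "rem x \<le> 1"
proof -
  have "-1 < rem x \<and> rem x \<le> 1"
  proof (cases "x = 0")
    case False
    define c where "c = \<lceil>1 / (2 * \<bar>x\<bar>)\<rceil>"
    have "real (quot x) = 2 * of_int c - 1"
      using int_quot[OF False] unfolding c_def by linarith
    moreover have "of_int c - 1 < 1 / (2 * \<bar>x\<bar>)" "1 / (2 * \<bar>x\<bar>) \<le> of_int c"
      unfolding c_def by linarith+
    moreover have "1 / \<bar>x\<bar> = 2 * (1 / (2 * \<bar>x\<bar>))" by simp
    ultimately show ?thesis unfolding rem_def by linarith
  qed auto
  then show "-1 < rem x" "rem x \<le> 1" by auto
qed

lemma abs_rem_le_1: "\<bar>rem x\<bar> \<le> 1"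
  using rem_bounds[of x] by auto

lemma quot_plus_rem: "quot x + rem x = 1 / \<bar>x\<bar>"
  by (simp add: rem_def)

lemma quot_plus_rem_ge_1: "x \<noteq> 0 \<Longrightarrow> \<bar>x\<bar> \<le> 1 \<Longrightarrow> quot x + rem x \<ge> 1"
  by (simp add: quot_plus_rem)

lemma quot_unique:
  assumes "odd a" "-1 < t" "t \<le> 1" "\<bar>x\<bar> = 1 / (real a + t)"
  shows "quot x = a" "rem x = t"
proof -
  have a: "real a \<ge> 1" using assms(1) by (cases a) auto
  obtain m where m: "a = 2 * m + 1" using assms(1) by (auto elim: oddE)
  have "1 / (2 * \<bar>x\<bar>) = (real a + t) / 2" using assms by simp
  then have "\<lceil>1 / (2 * \<bar>x\<bar>)\<rceil> = int m + 1"
    using assms m by (intro ceiling_unique) auto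
  then show q: "quot x = a" unfolding quot_def m by simp
  show "rem x = t" unfolding rem_def q using assms by simp
qed

definition expansion :: "real \<Rightarrow> ocf" where
  "expansion x =
     (if \<exists>n. (rem ^^ n) x = 0
      then Fin_OCF (map (\<lambda>i. digit ((rem ^^ i) x)) [0..<(LEAST n. (rem ^^ n) x = 0)])
      else Inf_OCF (\<lambda>i. digit ((rem ^^ i) x)))"

definition digits_ok :: "(int \<times> nat) list \<Rightarrow> bool" where
  "digits_ok ds \<longleftrightarrow>
     (\<forall>i < length ds. fst (ds ! i) \<in> {1, -1} \<and> odd (snd (ds ! i))) \<and>
     (\<forall>i. Suc i < length ds \<longrightarrow> int (snd (ds ! i)) + fst (ds ! Suc i) > 0)"

lemma digits_ok_Cons:
  "digits_ok ((e, a) # ds) \<longleftrightarrow>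
     e \<in> {1, -1} \<and> odd a \<and> (ds \<noteq> [] \<longrightarrow> int a + fst (hd ds) > 0) \<and> digits_ok ds"
  unfolding digits_ok_def
  apply (simp add: All_less_Suc2 hd_conv_nth)
  apply (rule iffI)
   apply (auto simp: hd_conv_nth)
  subgoal for i by (cases i) auto
  subgoal for i by (cases i) (auto simp: hd_conv_nth)
  done

text \<open>
  The bounds for a value and for the denominator above it are proved together. The denominator
  \<open>a + v\<close> can be less than \<open>1\<close> only if \<open>a = 1\<close> and \<open>v < 0\<close>, and this is what \<open>a\<^sub>i + e\<^sub>i\<^sub>+\<^sub>1 > 0\<close> forbids.
\<close>

lemma cf_value_bounds:
  "digits_ok ds \<Longrightarrow> \<bar>cf_value ds\<bar> \<le> 1 \<and> (ds \<noteq> [] \<longrightarrow> sgn (cf_value ds) = of_int (fst (hd ds)))"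
  "digits_ok ((e, a) # ds) \<Longrightarrow> real a + cf_value ds \<ge> 1"
proof -
  have *: "real a + cf_value ds \<ge> 1"
    if "digits_ok ((e, a) # ds)"
       "\<bar>cf_value ds\<bar> \<le> 1 \<and> (ds \<noteq> [] \<longrightarrow> sgn (cf_value ds) = of_int (fst (hd ds)))" for e a ds
  proof (cases "a = 1")
    case True
    have "cf_value ds \<ge> 0"
    proof (cases "ds = []")
      case False
      then obtain e' a' ds' where ds: "ds = (e', a') # ds'" by (cases ds) auto
      have "e' = 1" using that(1) True unfolding ds digits_ok_Cons by (simp, linarith)
      with that ds show ?thesis by (auto simp: sgn_if split: if_splits)
    qed simp
    with True show ?thesis by simp
  next
    case False
    with that have "a \<ge> 2" by (cases a) (auto simp: digits_ok_Cons)
    with that show ?thesis by linarith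
  qed
  show 1: "\<bar>cf_value ds\<bar> \<le> 1 \<and> (ds \<noteq> [] \<longrightarrow> sgn (cf_value ds) = of_int (fst (hd ds)))"
    if "digits_ok ds" for ds
    using that
  proof (induction ds)
    case (Cons d ds)
    obtain e a where d: "d = (e, a)" by force
    have ok: "digits_ok ds" and e: "e \<in> {1, -1}" using Cons.prems unfolding d digits_ok_Cons by auto
    have "real a + cf_value ds \<ge> 1" using * Cons.IH[OF ok] Cons.prems d by blast
    with e show ?case unfolding d by (auto simp: sgn_if field_simps)
  qed simp
  show "digits_ok ((e, a) # ds) \<Longrightarrow> real a + cf_value ds \<ge> 1"
    using * 1[of ds] by (auto simp: digits_ok_Cons)
qed

text \<open>
  The bound \<open>cf_value ds > -1\<close> is what makes the induction work: it puts every tail into the range in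
  which \<open>quot\<close> and \<open>rem\<close> recover the first digit and the tail. The value \<open>-1\<close> could
  only come from the single digit \<open>(-1, 1)\<close>, which is not allowed in last place.
\<close>

lemma finite_expansion_digits:
  assumes "digits_ok ds" "ds \<noteq> [] \<Longrightarrow> snd (last ds) = 1 \<Longrightarrow> fst (last ds) = 1"
  shows "ds = map (\<lambda>i. digit ((rem ^^ i) (cf_value ds))) [0..<length ds]
    \<and> (\<forall>i<length ds. (rem ^^ i) (cf_value ds) \<noteq> 0) \<and> (rem ^^ length ds) (cf_value ds) = 0
    \<and> cf_value ds > -1"
  using assms
proof (induction ds)
  case (Cons d ds)
  obtain e a where d: "d = (e, a)" by force
  define t where "t = cf_value ds"
  define x where "x = cf_value (d # ds)"
  have ok: "digits_ok ds" and e: "e \<in> {1, -1}" and a: "odd a"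
    using Cons.prems(1) unfolding d digits_ok_Cons by auto
  have last: "ds \<noteq> [] \<Longrightarrow> snd (last ds) = 1 \<Longrightarrow> fst (last ds) = 1" using Cons.prems(2) by auto
  note IH = Cons.IH[OF ok last, folded t_def]
  have t: "\<bar>t\<bar> \<le> 1" "real a + t \<ge> 1" "-1 < t"
    using cf_value_bounds(1)[OF ok] cf_value_bounds(2)[OF Cons.prems(1)[unfolded d]] IH
    by (auto simp: t_def)
  have x: "x = of_int e / (real a + t)" by (simp add: x_def d t_def)
  have absx: "\<bar>x\<bar> = 1 / (real a + t)" using e t x by auto
  have q: "quot x = a" "rem x = t"
    using quot_unique[OF a _ _ absx] t by auto
  have dx: "digit x = d" "x \<noteq> 0" using e t q(1) unfolding digit_def d x by auto
  have "x > -1"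
  proof (rule ccontr)
    assume "\<not> x > -1"
    then have "e = -1" and at: "real a + t = 1" using x e t by (auto simp: field_simps)
    moreover have "a = 1"
    proof (rule ccontr)
      assume "a \<noteq> 1"
      with a have "a \<ge> 3" by presburger
      with at t show False by auto
    qed
    ultimately have "t = 0" by simp
    then have "ds = []" using IH cf_value_bounds(1)[OF ok] ok e t_def
      by (metis funpow_rem_0 length_greater_0_conv)
    with Cons.prems(2) \<open>a = 1\<close> \<open>e = -1\<close> d show False by simp
  qed
  moreover have "(rem ^^ Suc i) x = (rem ^^ i) t" for i
    by (simp add: funpow_swap1 q)
  ultimately show ?case
    using IH dx unfolding x_def[symmetric]
    by (auto simp: map_upt_Suc All_less_Suc2 simp del: funpow.simps upt_Suc)
qed simp

text \<open>
  If an infinite fraction converges, then so does its tail. The limit is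
  not \<open>0\<close>, since all truncations have modulus at least \<open>1 / (a + 1)\<close>, and the first step of the
  fraction can be undone in the limit.
\<close>

lemma infinite_expansion_step:
  assumes ok: "\<forall>i. fst (d i) \<in> {1, -1} \<and> odd (snd (d i))"
      "\<forall>i. int (snd (d i)) + fst (d (Suc i)) > 0"
    and lim: "(\<lambda>n. cf_value (map d [0..<n])) \<longlonglongrightarrow> x"
  shows "x \<noteq> 0" "\<bar>x\<bar> \<le> 1" "sgn x = of_int (fst (d 0))"
    "(\<lambda>n. cf_value (map (\<lambda>i. d (Suc i)) [0..<n])) \<longlonglongrightarrow> 1 / \<bar>x\<bar> - snd (d 0)"
proof -
  obtain e a where d0: "d 0 = (e, a)" by force
  define y where "y n = cf_value (map (\<lambda>i. d (Suc i)) [0..<n])" for n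
  have e: "e \<in> {1, -1}" using ok(1)[rule_format, of 0] d0 by simp
  have Cons: "map d [0..<Suc n] = (e, a) # map (\<lambda>i. d (Suc i)) [0..<n]" for n
    using d0 by (simp add: map_upt_Suc del: upt_Suc)
  have okn: "digits_ok (map d [0..<n])" for n using ok by (auto simp: digits_ok_def)
  have okn': "digits_ok (map (\<lambda>i. d (Suc i)) [0..<n])" for n using ok by (auto simp: digits_ok_def)
  have y: "\<bar>y n\<bar> \<le> 1" "real a + y n \<ge> 1" for n
    using cf_value_bounds(1)[OF okn'] cf_value_bounds(2)[OF okn[of "Suc n", unfolded Cons]]
    by (auto simp: y_def)
  have val: "cf_value (map d [0..<Suc n]) = of_int e / (real a + y n)" for n
    unfolding Cons y_def by simp
  have lim': "(\<lambda>n. of_int e / (real a + y n)) \<longlonglongrightarrow> x"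
    using LIMSEQ_Suc[OF lim] unfolding val .
  from tendsto_mult[OF tendsto_const[of "of_int e"] this]
  have lim2: "(\<lambda>n. 1 / (real a + y n)) \<longlonglongrightarrow> of_int e * x"
    using e by auto
  have "1 / (real a + 1) \<le> of_int e * x"
  proof (rule LIMSEQ_le_const[OF lim2], intro exI allI impI)
    show "1 / (real a + 1) \<le> 1 / (real a + y n)" for n
      using y[of n] by (intro divide_left_mono) auto
  qed
  moreover have "1 / (real a + 1) > 0" by simp
  ultimately have pos: "of_int e * x > 0" by linarith
  then show x0: "x \<noteq> 0" by auto
  show sgn: "sgn x = of_int (fst (d 0))" using e pos d0 by (auto simp: sgn_if)
  have "of_int e * x \<le> 1"
  proof (rule LIMSEQ_le_const2[OF lim2], intro exI allI impI)
    show "1 / (real a + y n) \<le> 1" for n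
      using y(2)[of n] by (subst divide_le_eq_1_pos) auto
  qed
  then show "\<bar>x\<bar> \<le> 1" using e pos by auto
  have absx: "\<bar>x\<bar> = of_int e * x" using e pos by auto
  have "(\<lambda>n. 1 / (1 / (real a + y n)) - real a) \<longlonglongrightarrow> 1 / (of_int e * x) - real a"
    using pos by (intro tendsto_intros lim2) auto
  then show "(\<lambda>n. cf_value (map (\<lambda>i. d (Suc i)) [0..<n])) \<longlonglongrightarrow> 1 / \<bar>x\<bar> - snd (d 0)"
    unfolding y_def[symmetric] absx d0 by simp
qed

text \<open>
  Two applications of the previous lemma to tails are needed in order to exclude the remainder \<open>-1\<close>:
  its own tail has to be known to be nonzero.
\<close>

lemma infinite_expansion_rem:
  assumes ok: "\<forall>i. fst (d i) \<in> {1, -1} \<and> odd (snd (d i))"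
      "\<forall>i. int (snd (d i)) + fst (d (Suc i)) > 0"
    and lim: "(\<lambda>n. cf_value (map d [0..<n])) \<longlonglongrightarrow> x"
  shows "digit x = d 0" "(\<lambda>n. cf_value (map (\<lambda>i. d (Suc i)) [0..<n])) \<longlonglongrightarrow> rem x"
proof -
  obtain e a where d0: "d 0 = (e, a)" by force
  define y where "y = 1 / \<bar>x\<bar> - a"
  have e: "e \<in> {1, -1}" and a: "odd a" using ok(1)[rule_format, of 0] d0 by auto
  note x = infinite_expansion_step[OF assms, unfolded d0 snd_conv, folded y_def]
  have ok': "\<forall>i. fst (d (Suc i)) \<in> {1, -1} \<and> odd (snd (d (Suc i)))"
      "\<forall>i. int (snd (d (Suc i))) + fst (d (Suc (Suc i))) > 0"
    using ok by auto
  note y = infinite_expansion_step[of "\<lambda>i. d (Suc i)", OF ok' x(4)]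
  obtain e' a' where d1: "d (Suc 0) = (e', a')" by force
  define z where "z = 1 / \<bar>y\<bar> - a'"
  have ok'': "\<forall>i. fst (d (Suc (Suc i))) \<in> {1, -1} \<and> odd (snd (d (Suc (Suc i))))"
      "\<forall>i. int (snd (d (Suc (Suc i)))) + fst (d (Suc (Suc (Suc i)))) > 0"
    using ok by auto
  have "(\<lambda>n. cf_value (map (\<lambda>i. d (Suc (Suc i))) [0..<n])) \<longlonglongrightarrow> z"
    using y(4) unfolding z_def d1 by simp
  note z = infinite_expansion_step[of "\<lambda>i. d (Suc (Suc i))", OF ok'' this]
  have a': "odd a'" using ok(1)[rule_format, of 1] d1 by auto
  obtain e'' a'' where d2: "d (Suc (Suc 0)) = (e'', a'')" by force
  have "int a' + e'' > 0" using ok(2)[rule_format, of 1] d1 d2 by simp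
  have "e'' \<in> {1, -1}" using ok(1)[rule_format, of 2] d2 by (simp add: numeral_2_eq_2)
  \<comment> \<open>A remainder \<open>-1\<close> would force the digit \<open>(-1, 1)\<close> with nothing after it.\<close>
  have "real a' + z > 1"
  proof (cases "a' = 1")
    case True
    with \<open>int a' + e'' > 0\<close> \<open>e'' \<in> {1, -1}\<close> have "e'' = 1" by auto
    with z(3) d2 have "z > 0" by (auto simp: sgn_if split: if_splits)
    with True show ?thesis by simp
  next
    case False
    with a' have "a' \<ge> 3" by presburger
    with z(2) show ?thesis by linarith
  qed
  then have "\<bar>y\<bar> \<noteq> 1" unfolding z_def by auto
  then have y': "-1 < y" "y \<le> 1" using y(2) by auto
  have absx: "\<bar>x\<bar> = 1 / (real a + y)" unfolding y_def by simp
  note q = quot_unique[OF a y' absx]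
  show "digit x = d 0" using e x(3) unfolding digit_def d0 q(1)
    by (auto simp: sgn_if split: if_splits)
  show "(\<lambda>n. cf_value (map (\<lambda>i. d (Suc i)) [0..<n])) \<longlonglongrightarrow> rem x"
    using x(4) unfolding q(2) .
qed

lemma infinite_expansion_digits:
  assumes ok: "\<forall>i. fst (d i) \<in> {1, -1} \<and> odd (snd (d i))"
      "\<forall>i. int (snd (d i)) + fst (d (Suc i)) > 0"
    and lim: "(\<lambda>n. cf_value (map d [0..<n])) \<longlonglongrightarrow> x"
  shows "(rem ^^ n) x \<noteq> 0 \<and> digit ((rem ^^ n) x) = d n"
  using assms
proof (induction n arbitrary: d x)
  case 0
  from infinite_expansion_step(1)[OF this] infinite_expansion_rem(1)[OF this] show ?case by simp
next
  case (Suc n)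
  from Suc.IH[of "\<lambda>i. d (Suc i)" "rem x"] infinite_expansion_rem(2)[OF Suc.prems] Suc.prems(1,2)
  show ?case by (simp add: funpow_swap1)
qed

lemma expansion_unique:
  assumes "ocf_admissible d" "ocf_represents d x"
  shows "d = expansion x"
proof (cases d)
  case (Fin_OCF ds)
  have x: "x = cf_value ds" using assms(2) Fin_OCF by simp
  have ok: "digits_ok ds" "ds \<noteq> [] \<Longrightarrow> snd (last ds) = 1 \<Longrightarrow> fst (last ds) = 1"
    using assms(1) Fin_OCF by (auto simp: digits_ok_def)
  note D = finite_expansion_digits[OF ok, folded x]
  have "(LEAST n. (rem ^^ n) x = 0) = length ds"
    using D by (intro Least_equality) (auto intro: leI)
  with D show ?thesis unfolding Fin_OCF expansion_def by auto
next
  case (Inf_OCF e)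
  have "(rem ^^ n) x \<noteq> 0 \<and> digit ((rem ^^ n) x) = e n" for n
    using assms Inf_OCF by (intro infinite_expansion_digits) auto
  then show ?thesis unfolding Inf_OCF expansion_def by (auto simp: fun_eq_iff)
qed

section \<open>Contraction\<close>

text \<open>The fraction \<open>cf_value\<close> with an arbitrary real remainder below its last digit.\<close>

fun cf_tail :: "(int \<times> nat) list \<Rightarrow> real \<Rightarrow> real" where
  "cf_tail [] t = t"
| "cf_tail ((e, a) # ds) t = of_int e / (of_nat a + cf_tail ds t)"

text \<open>
  The sign conditions on the digits are replaced by their effect on the denominators. In this form
  they also make sense for a real remainder.
\<close>

fun valid_tail :: "(int \<times> nat) list \<Rightarrow> real \<Rightarrow> bool" where
  "valid_tail [] t \<longleftrightarrow> True"
| "valid_tail ((e, a) # ds) t \<longleftrightarrow>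
     e \<in> {1, -1} \<and> odd a \<and> of_nat a + cf_tail ds t \<ge> 1 \<and> valid_tail ds t"

lemma cf_tail_0: "cf_tail ds 0 = cf_value ds"
  by (induction ds rule: cf_value.induct) auto

lemma valid_tail_0: "digits_ok ds \<Longrightarrow> valid_tail ds 0"
proof (induction ds)
  case (Cons d ds)
  obtain e a where d: "d = (e, a)" by force
  show ?case using Cons cf_value_bounds(2)[of e a ds] unfolding d
    by (auto simp: cf_tail_0 digits_ok_Cons)
qed simp

text \<open>
  One step does not expand, and two steps contract by \<open>1/4\<close>: with \<open>w\<close> the value below, the derivative
  of \<open>w \<mapsto> e / (a + e' / (a' + w))\<close> has modulus \<open>1 / (a (a' + w) + e')\<^sup>2\<close>, and
  \<open>a (a' + w) + e' \<ge> 2\<close>. Hence the induction removes two digits at a time.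
\<close>

lemma cf_tail_contraction:
  "valid_tail ds s \<Longrightarrow> valid_tail ds t \<Longrightarrow>
     \<bar>cf_tail ds s - cf_tail ds t\<bar> \<le> 2 * (1/2) ^ length ds * \<bar>s - t\<bar>"
proof (induction ds rule: induct_list012)
  case (2 d)
  obtain e a where d: "d = (e, a)" by force
  have e: "e \<in> {1, -1}" and s: "real a + s \<ge> 1" and t: "real a + t \<ge> 1" using 2 d by auto
  have "1 * 1 \<le> (real a + s) * (real a + t)" using s t by (intro mult_mono) auto
  moreover have "of_int e / (real a + s) - of_int e / (real a + t)
      = of_int e * (t - s) / ((real a + s) * (real a + t))"
    using s t by (simp add: field_simps)
  then have "\<bar>of_int e / (real a + s) - of_int e / (real a + t)\<bar>
      = \<bar>s - t\<bar> / ((real a + s) * (real a + t))"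
    using e s t by (auto simp: abs_mult abs_minus_commute)
  moreover have "\<bar>s - t\<bar> / ((real a + s) * (real a + t)) \<le> \<bar>s - t\<bar> / 1"
    using calculation(1) by (intro divide_left_mono) auto
  ultimately show ?case unfolding d by simp
next
  case (3 d d' ds)
  obtain e a where d: "d = (e, a)" by force
  obtain e' a' where d': "d' = (e', a')" by force
  define u where "u = cf_tail ds s"
  define v where "v = cf_tail ds t"
  have e: "e \<in> {1, -1}" "e' \<in> {1, -1}" and a: "odd a"
    and u: "real a' + u \<ge> 1" "real a + of_int e' / (real a' + u) \<ge> 1"
    and v: "real a' + v \<ge> 1" "real a + of_int e' / (real a' + v) \<ge> 1"
    and valid: "valid_tail ds s" "valid_tail ds t"
    using 3 unfolding d d' u_def v_def by auto
  \<comment> \<open>If \<open>a = 1\<close>, then a negative \<open>e'\<close> would make the outer denominator less than \<open>1\<close>.\<close>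
  have *: "2 \<le> real a * (real a' + w) + of_int e'"
    if "real a' + w \<ge> 1" "real a + of_int e' / (real a' + w) \<ge> 1" for w
  proof (cases "a = 1")
    case True
    with that e have "e' = 1" by (auto simp: field_simps)
    with True that show ?thesis by simp
  next
    case False
    with a have "a \<ge> 3" by presburger
    then have "3 * 1 \<le> real a * (real a' + w)" using that(1) by (intro mult_mono) auto
    with e show ?thesis by auto
  qed
  define U where "U = real a * (real a' + u) + of_int e'"
  define V where "V = real a * (real a' + v) + of_int e'"
  have U: "U \<ge> 2" and V: "V \<ge> 2" unfolding U_def V_def using * u v by auto
  have eq: "of_int e / (real a + of_int e' / (real a' + u)) = of_int e * (real a' + u) / U"
      "of_int e / (real a + of_int e' / (real a' + v)) = of_int e * (real a' + v) / V"
    unfolding U_def V_def using u v by (auto simp: divide_simps)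
  have "of_int e * (real a' + u) / U - of_int e * (real a' + v) / V
      = of_int e * of_int e' * (u - v) / (U * V)"
    using U V by (simp add: field_simps) (simp add: U_def V_def algebra_simps)
  then have "\<bar>of_int e * (real a' + u) / U - of_int e * (real a' + v) / V\<bar> = \<bar>u - v\<bar> / (U * V)"
    using e U V by (auto simp: abs_mult abs_minus_commute)
  moreover have "2 * 2 \<le> U * V" using U V by (intro mult_mono) auto
  then have "\<bar>u - v\<bar> / (U * V) \<le> \<bar>u - v\<bar> / 4"
    by (intro divide_left_mono) auto
  moreover have "\<bar>u - v\<bar> \<le> 2 * (1/2) ^ length ds * \<bar>s - t\<bar>"
    using 3 valid unfolding u_def v_def by simp
  ultimately have "\<bar>of_int e * (real a' + u) / U - of_int e * (real a' + v) / V\<bar>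
      \<le> (2 * (1/2) ^ length ds * \<bar>s - t\<bar>) / 4"
    by (metis divide_right_mono order_trans zero_le_numeral)
  then show ?case unfolding d d' by (simp add: u_def[symmetric] v_def[symmetric] eq mult.commute)
qed simp

lemma rem_orbit_tail:
  assumes "\<bar>x\<bar> \<le> 1" "\<And>i. i < n \<Longrightarrow> (rem ^^ i) x \<noteq> 0"
  shows "cf_tail (map (\<lambda>i. digit ((rem ^^ i) x)) [0..<n]) ((rem ^^ n) x) = x
    \<and> valid_tail (map (\<lambda>i. digit ((rem ^^ i) x)) [0..<n]) ((rem ^^ n) x)"
  using assms
proof (induction n arbitrary: x)
  case (Suc n)
  have x0: "x \<noteq> 0" using Suc.prems(2)[of 0] by simp
  have "(rem ^^ i) (rem x) \<noteq> 0" if "i < n" for i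
    using Suc.prems(2)[of "Suc i"] that by (simp add: funpow_swap1)
  from Suc.IH[OF abs_rem_le_1 this]
  show ?case
    using x0 odd_quot[OF x0] quot_plus_rem_ge_1[OF x0 Suc.prems(1)]
    by (auto simp: map_upt_Suc digit_def funpow_swap1 quot_plus_rem simp del: upt_Suc)
qed simp

lemma digits_determine:
  assumes "\<bar>x\<bar> \<le> 1" "\<bar>y\<bar> \<le> 1"
    and "\<And>n. (rem ^^ n) x \<noteq> 0" "\<And>n. (rem ^^ n) y \<noteq> 0"
    and "\<And>n. digit ((rem ^^ n) x) = digit ((rem ^^ n) y)"
  shows "x = y"
proof -
  have orb: "\<bar>(rem ^^ n) z\<bar> \<le> 1" if "\<bar>z\<bar> \<le> 1" for z n
    using that abs_rem_le_1 by (cases n) auto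
  have "\<bar>x - y\<bar> \<le> 4 * (1/2) ^ n" for n
  proof -
    define ds where "ds = map (\<lambda>i. digit ((rem ^^ i) x)) [0..<n]"
    have ds': "ds = map (\<lambda>i. digit ((rem ^^ i) y)) [0..<n]" unfolding ds_def using assms(5) by simp
    have "\<bar>x - y\<bar> \<le> 2 * (1/2) ^ n * \<bar>(rem ^^ n) x - (rem ^^ n) y\<bar>"
      using cf_tail_contraction[of ds "(rem ^^ n) x" "(rem ^^ n) y"]
        rem_orbit_tail[of x n, folded ds_def] rem_orbit_tail[of y n, folded ds'] assms
      by (simp add: ds_def)
    also have "\<dots> \<le> 2 * (1/2) ^ n * 2"
      using orb[OF assms(1), of n] orb[OF assms(2), of n] by (intro mult_left_mono) auto
    finally show ?thesis by simp
  qed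
  moreover have lim: "(\<lambda>n. 4 * (1/2) ^ n :: real) \<longlonglongrightarrow> 0"
    by (intro tendsto_mult_right_zero LIMSEQ_power_zero) auto
  ultimately have "\<bar>x - y\<bar> \<le> 0" by (intro LIMSEQ_le_const[OF lim]) blast
  then show ?thesis by simp
qed

lemma abs_orbit_le_1: "\<bar>x\<bar> \<le> 1 \<Longrightarrow> \<bar>(rem ^^ n) x\<bar> \<le> 1"
  using abs_rem_le_1 by (cases n) auto

lemma digits_ok_orbit:
  assumes "\<bar>x\<bar> \<le> 1" "\<And>i. i < n \<Longrightarrow> (rem ^^ i) x \<noteq> 0"
  shows "digits_ok (map (\<lambda>i. digit ((rem ^^ i) x)) [0..<n])"
proof -
  have "int (quot ((rem ^^ i) x)) + fst (digit ((rem ^^ Suc i) x)) > 0" if "Suc i < n" for i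
  proof -
    define z where "z = (rem ^^ i) x"
    have z: "z \<noteq> 0" using assms that by (simp add: z_def)
    have z1: "\<bar>z\<bar> \<le> 1" using assms abs_orbit_le_1 by (simp add: z_def)
    have "quot z \<noteq> 1" if "rem z < 0"
      using quot_plus_rem_ge_1[OF z z1] that by auto
    then show ?thesis using quot_ge_1[OF z]
      by (force simp: digit_def z_def[symmetric])
  qed
  then show ?thesis unfolding digits_ok_def using assms odd_quot by (auto simp: digit_def)
qed

lemma ocf_of_eq_expansion:
  assumes x: "x \<in> {0..1}"
  shows "ocf_of x = expansion x"
proof -
  let ?r = "\<lambda>i. (rem ^^ i) x"
  have x1: "\<bar>x\<bar> \<le> 1" using x by auto
  have fst0: "fst (digit x) = 1" using x by (auto simp: digit_def)
  have "ocf_admissible (expansion x) \<and> ocf_represents (expansion x) x"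
  proof (cases "\<exists>n. ?r n = 0")
    case True
    define N where "N = (LEAST n. ?r n = 0)"
    have N: "?r N = 0" unfolding N_def using True by (rule LeastI_ex)
    have nz: "?r i \<noteq> 0" if "i < N" for i using that not_less_Least unfolding N_def by blast
    define ds where "ds = map (\<lambda>i. digit (?r i)) [0..<N]"
    have e: "expansion x = Fin_OCF ds" using True by (simp add: expansion_def ds_def N_def)
    have ok: "digits_ok ds" unfolding ds_def by (intro digits_ok_orbit x1 nz)
    have rep: "x = cf_value ds"
      using rem_orbit_tail[OF x1, of N] nz N by (simp add: ds_def cf_tail_0)
    \<comment> \<open>A last digit \<open>1\<close> belongs to an iterate of modulus \<open>1\<close>, and \<open>-1\<close> is not a remainder.\<close>
    have "fst (last ds) = 1" if "ds \<noteq> []" "snd (last ds) = 1"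
    proof -
      from that(1) obtain M where M: "N = Suc M" unfolding ds_def by (cases N) auto
      have l: "last ds = digit (?r M)" unfolding ds_def M by simp
      have "rem (?r M) = 0" using N M by simp
      with that l quot_plus_rem[of "?r M"] have "\<bar>?r M\<bar> = 1" by (auto simp: digit_def field_simps)
      moreover have "?r M > -1 \<or> M = 0" using rem_bounds by (cases M) auto
      ultimately show ?thesis using l fst0 by (auto simp: digit_def)
    qed
    moreover have "ds \<noteq> [] \<longrightarrow> fst (ds ! 0) = 1" using fst0 by (auto simp: ds_def)
    ultimately show ?thesis using ok rep unfolding e by (simp add: digits_ok_def)
  next
    case False
    define d where "d = (\<lambda>i. digit (?r i))"
    have e: "expansion x = Inf_OCF d" using False by (simp add: expansion_def d_def)
    have ok: "digits_ok (map d [0..<n])" for n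
      unfolding d_def using False by (intro digits_ok_orbit x1) auto
    have "ocf_admissible (Inf_OCF d)"
    proof -
      have "fst (d i) \<in> {1, -1} \<and> odd (snd (d i)) \<and> int (snd (d i)) + fst (d (Suc i)) > 0" for i
        using ok[of "Suc (Suc i)"] unfolding digits_ok_def
        by (metis (no_types, lifting) add_0 diff_zero length_map length_upt lessI less_SucI nth_map_upt)
      with fst0 show ?thesis by (simp add: d_def)
    qed
    moreover have "(\<lambda>n. cf_value (map d [0..<n])) \<longlonglongrightarrow> x"
    proof (rule LIM_zero_cancel, rule Lim_null_comparison)
      show "(\<lambda>n. 2 * (1/2) ^ n :: real) \<longlonglongrightarrow> 0"
        by (intro tendsto_mult_right_zero LIMSEQ_power_zero) auto
      have "\<bar>cf_value (map d [0..<n]) - x\<bar> \<le> 2 * (1/2) ^ n" for n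
      proof -
        have "\<bar>cf_tail (map d [0..<n]) (?r n) - cf_tail (map d [0..<n]) 0\<bar> \<le>
            2 * (1/2) ^ length (map d [0..<n]) * \<bar>?r n - 0\<bar>"
          using rem_orbit_tail[OF x1, of n] False
          by (intro cf_tail_contraction valid_tail_0 ok) (simp add: d_def)
        also have "\<dots> \<le> 2 * (1/2) ^ n * 1"
          using abs_orbit_le_1[OF x1, of n] by (simp add: mult_left_le)
        finally show ?thesis
          using rem_orbit_tail[OF x1, of n] False by (simp add: d_def cf_tail_0 abs_minus_commute)
      qed
      then show "\<forall>\<^sub>F n in sequentially. norm (cf_value (map d [0..<n]) - x) \<le> 2 * (1/2) ^ n"
        by simp
    qed
    ultimately show ?thesis unfolding e by simp
  qed
  then show ?thesis unfolding ocf_of_def using expansion_unique by (intro the_equality) blast+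
qed

section \<open>The functional equation\<close>

text \<open>
  The factor by which one digit changes the terms of the series. It is \<open>0\<close> at \<open>0\<close>, so that one
  infinite series covers the finite expansions as well.
\<close>

definition weight :: "real \<Rightarrow> real" where
  "weight x = - sgn x / lam ^ quot x"

text \<open>The odd extension of \<open>Q_O\<close> to negative arguments.\<close>

definition odd_Q :: "real \<Rightarrow> real" where
  "odd_Q x = - lam * (\<Sum>n. \<Prod>i\<le>n. weight ((rem ^^ i) x))"

lemma weight_minus: "weight (- x) = - weight x"
  by (simp add: weight_def sgn_minus)

lemma abs_weight: "\<bar>weight x\<bar> \<le> 1 / lam"
proof (cases "x = 0")
  case False
  have "lam ^ 1 \<le> lam ^ quot x" using quot_ge_1[OF False] lam_gt_1 by (intro power_increasing) auto
  then show ?thesis using False lam_pos by (auto simp: weight_def abs_sgn_eq field_simps)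
qed (use lam_pos in \<open>simp add: weight_def\<close>)

lemma abs_prod_weight: "\<bar>\<Prod>i\<le>n. weight ((rem ^^ i) x)\<bar> \<le> (1 / lam) ^ n"
proof -
  have "\<bar>\<Prod>i\<le>n. weight ((rem ^^ i) x)\<bar> \<le> (\<Prod>i\<le>n. 1 / lam)"
    unfolding abs_prod by (intro prod_mono) (auto intro: abs_weight)
  also have "\<dots> = (1 / lam) ^ Suc n" by simp
  also have "\<dots> \<le> (1 / lam) ^ n" using lam_gt_1 by (intro power_decreasing) auto
  finally show ?thesis .
qed

lemma summable_lam: "summable (\<lambda>n. (1 / lam) ^ n)"
  using lam_gt_1 by (intro summable_geometric) auto

lemma summable_prod_weight: "summable (\<lambda>n. \<Prod>i\<le>n. weight ((rem ^^ i) x))"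
  using abs_prod_weight by (intro summable_comparison_test[OF _ summable_lam]) auto

lemma odd_Q_bounded: "\<exists>B\<ge>0. \<forall>x. \<bar>odd_Q x\<bar> \<le> B"
proof (intro exI conjI allI)
  have "\<bar>\<Sum>n. \<Prod>i\<le>n. weight ((rem ^^ i) x)\<bar> \<le> (\<Sum>n. (1 / lam) ^ n)" for x
    unfolding real_norm_def[symmetric]
    by (rule norm_suminf_le[OF _ summable_lam]) (use abs_prod_weight in simp)
  then show "\<bar>odd_Q x\<bar> \<le> lam * (\<Sum>n. (1 / lam) ^ n)" for x
    unfolding odd_Q_def using lam_pos by (simp add: abs_mult)
  show "lam * (\<Sum>n. (1 / lam) ^ n) \<ge> 0"
    using lam_pos by (intro mult_nonneg_nonneg suminf_nonneg summable_lam) auto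
qed

lemma odd_Q_rem: "odd_Q x = weight x * (odd_Q (rem x) - lam)"
proof -
  have "(\<Sum>n. \<Prod>i\<le>n. weight ((rem ^^ i) x))
      = weight x + (\<Sum>n. \<Prod>i\<le>Suc n. weight ((rem ^^ i) x))"
    using suminf_split_head[OF summable_prod_weight[of x]] by simp
  also have "(\<lambda>n. \<Prod>i\<le>Suc n. weight ((rem ^^ i) x))
      = (\<lambda>n. weight x * (\<Prod>i\<le>n. weight ((rem ^^ i) (rem x))))"
    unfolding prod.atMost_Suc_shift by (simp add: funpow_swap1)
  also have "suminf \<dots> = weight x * (\<Sum>n. \<Prod>i\<le>n. weight ((rem ^^ i) (rem x)))"
    by (rule suminf_mult[OF summable_prod_weight])
  finally show ?thesis unfolding odd_Q_def by (simp add: algebra_simps)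
qed

lemma odd_Q_0 [simp]: "odd_Q 0 = 0"
  by (subst odd_Q_rem) (simp add: weight_def)

lemma odd_Q_minus: "odd_Q (- x) = - odd_Q x"
  by (subst (1 2) odd_Q_rem) (simp add: weight_minus)

lemma odd_Q_pos: "x > 0 \<Longrightarrow> odd_Q x = (lam - odd_Q (rem x)) / lam ^ quot x"
  by (subst odd_Q_rem) (simp add: weight_def diff_divide_distrib)

lemma odd_Q_1 [simp]: "odd_Q 1 = 1"
  using odd_Q_pos[of 1] quot_unique[of 1 0 1] lam_pos by simp

lemma lam_step: "(lam + 1) / lam ^ (a + 2) = (lam - 1) / lam ^ a"
  using lam_pos unfolding lam_plus_1 power_add by simp

text \<open>
  For \<open>t > -1\<close> this is the recursion along the orbit. For \<open>t = -1\<close> the point \<open>1 / (a - 1)\<close> really has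
  the digit \<open>a - 2\<close> and the remainder \<open>1\<close>, and the two right-hand sides agree by \<open>lam_step\<close>.
\<close>

lemma odd_Q_inverse:
  assumes "odd a" "\<bar>t\<bar> \<le> 1" "real a + t \<ge> 1"
  shows "odd_Q (1 / (real a + t)) = (lam - odd_Q t) / lam ^ a"
proof (cases "t = -1")
  case False
  have "\<bar>1 / (real a + t)\<bar> = 1 / (real a + t)" using assms by simp
  from quot_unique[OF assms(1) _ _ this] False assms odd_Q_pos[of "1 / (real a + t)"]
  show ?thesis by auto
next
  case True
  have "2 \<le> a" using assms(3) True by linarith
  define b where "b = a - 2"
  have a: "a = b + 2" "odd b" using \<open>2 \<le> a\<close> assms(1) by (auto simp: b_def)
  have "\<bar>1 / (real a + t)\<bar> = 1 / (real b + 1)" using a True by simp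
  from quot_unique[OF a(2) _ _ this] odd_Q_pos[of "1 / (real a + t)"] a True
  have "odd_Q (1 / (real a + t)) = (lam - 1) / lam ^ b" by simp
  with lam_step[of b] a True show ?thesis by (simp add: odd_Q_minus)
qed

lemma Q_O_eq_odd_Q:
  assumes "x \<in> {0..1}"
  shows "Q_O x = odd_Q x"
proof -
  let ?r = "\<lambda>i. (rem ^^ i) x"
  let ?p = "\<lambda>k. \<Prod>i\<le>k. weight (?r i)"
  have Q_term_eq: "Q_term d k = lam * ?p k"
    if "\<And>i. i \<le> k \<Longrightarrow> d i = digit (?r i)" "\<And>i. i \<le> k \<Longrightarrow> ?r i \<noteq> 0" for d k
  proof -
    have sgn: "(\<Prod>i\<le>k. - real_of_int (fst (d i))) = (\<Prod>i\<le>k. - sgn (?r i))"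
      using that by (intro prod.cong) (auto simp: digit_def sgn_if)
    have pow: "(\<Sum>i\<le>k. snd (d i)) = (\<Sum>i\<le>k. quot (?r i))"
      using that by (intro sum.cong) (auto simp: digit_def)
    have "1 \<le> quot (?r 0)" using that(2)[of 0] by (intro quot_ge_1) auto
    also have "\<dots> \<le> (\<Sum>i\<le>k. quot (?r i))" by (intro member_le_sum) auto
    finally have "(\<Sum>i\<le>k. quot (?r i)) = Suc ((\<Sum>i\<le>k. quot (?r i)) - 1)" by simp
    then have "lam ^ (\<Sum>i\<le>k. quot (?r i)) = lam * lam ^ ((\<Sum>i\<le>k. quot (?r i)) - 1)"
      by (metis power_Suc)
    moreover have "?p k = (\<Prod>i\<le>k. - sgn (?r i)) / lam ^ (\<Sum>i\<le>k. quot (?r i))"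
      unfolding weight_def prod_dividef power_sum ..
    ultimately show ?thesis unfolding Q_term_def sgn pow using lam_pos by simp
  qed
  show ?thesis
  proof (cases "\<exists>n. ?r n = 0")
    case True
    define N where "N = (LEAST n. ?r n = 0)"
    have N: "?r N = 0" unfolding N_def using True by (rule LeastI_ex)
    have nz: "?r i \<noteq> 0" if "i < N" for i using that not_less_Least unfolding N_def by blast
    define ds where "ds = map (\<lambda>i. digit (?r i)) [0..<N]"
    have e: "expansion x = Fin_OCF ds" using True by (simp add: expansion_def ds_def N_def)
    have "Q_O x = - (\<Sum>k<N. lam * ?p k)"
      unfolding Q_O_def ocf_of_eq_expansion[OF assms] e ocf_Q.simps
      using nz by (auto intro!: sum.cong Q_term_eq simp: ds_def)
    moreover have "suminf ?p = (\<Sum>k<N. ?p k)"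
    proof (rule suminf_finite)
      fix k assume "k \<notin> {..<N}"
      then have "weight (?r N) = 0" "N \<in> {..k}" using N by (auto simp: weight_def)
      then show "?p k = 0" by (metis finite_atMost prod_zero)
    qed simp
    ultimately show ?thesis unfolding odd_Q_def by (simp add: sum_distrib_left[symmetric])
  next
    case False
    then have e: "expansion x = Inf_OCF (\<lambda>i. digit (?r i))" by (simp add: expansion_def)
    have "Q_term (\<lambda>i. digit (?r i)) = (\<lambda>k. lam * ?p k)"
      using False by (intro ext Q_term_eq) auto
    then have "Q_O x = - (\<Sum>k. lam * ?p k)"
      unfolding Q_O_def ocf_of_eq_expansion[OF assms] e by simp
    then show ?thesis unfolding odd_Q_def by (simp add: suminf_mult[OF summable_prod_weight])
  qed
qed


section \<open>Monotonicity and continuity\<close>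

lemma divide_lam_power_le: "0 \<le> c \<Longrightarrow> b \<le> a \<Longrightarrow> c / lam ^ a \<le> c / lam ^ b"
  using lam_gt_1 by (intro divide_left_mono power_increasing mult_pos_pos zero_less_power) auto

text \<open>
  For distinct odd \<open>a\<close> the images of \<open>{-1..1}\<close> under \<open>s \<mapsto> (lam - s) / lam ^ a\<close> are ordered intervals
  that have at most an end point in common.
\<close>

lemma lam_branch_le:
  assumes "odd a" "odd b" "b < a"
  shows "(lam + 1) / lam ^ a \<le> (lam - 1) / lam ^ b"
proof -
  have "b + 2 \<le> a" using assms by presburger
  from divide_lam_power_le[OF _ this, of "lam + 1"] show ?thesis
    using lam_step[of b] lam_pos by simp
qed

text \<open>
  Summing absolute values only bounds \<open>odd_Q\<close> by a constant greater than \<open>1\<close>. The sharp range follows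
  since each use of the functional equation divides the excess by at least \<open>lam\<close>.
\<close>

lemma odd_Q_approx_range:
  assumes B: "B \<ge> 0" "\<And>x. \<bar>odd_Q x\<bar> \<le> B"
  shows "x \<in> {0..1} \<Longrightarrow> - (B / lam ^ n) \<le> odd_Q x \<and> odd_Q x \<le> 1 + B / lam ^ n"
proof (induction n arbitrary: x)
  case 0
  with B(2)[of x] show ?case by auto
next
  case (Suc n)
  define \<epsilon> where "\<epsilon> = B / lam ^ n"
  have \<epsilon>: "\<epsilon> \<ge> 0" using B lam_pos by (simp add: \<epsilon>_def)
  have \<epsilon>': "B / lam ^ Suc n = \<epsilon> / lam" by (simp add: \<epsilon>_def)
  show ?case
  proof (cases "x = 0")
    case False
    then have x: "x > 0" "x \<noteq> 0" using Suc.prems by auto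
    define a where "a = quot x"
    define t where "t = rem x"
    have a1: "1 \<le> a" unfolding a_def by (rule quot_ge_1[OF x(2)])
    have eq: "odd_Q x = (lam - odd_Q t) / lam ^ a"
      using odd_Q_pos[OF x(1)] by (simp add: a_def t_def)
    have t1: "\<bar>t\<bar> \<le> 1" unfolding t_def by (rule abs_rem_le_1)
    have "-(\<epsilon> / lam) \<le> - (\<epsilon> / lam ^ a)"
      using divide_lam_power_le[OF \<epsilon> a1] by simp
    also have "\<dots> \<le> (lam - odd_Q t) / lam ^ a"
    proof -
      have "odd_Q t \<le> 1 + \<epsilon>"
      proof (cases "t \<ge> 0")
        case False
        then have "- odd_Q t \<ge> -\<epsilon>" using Suc.IH[of "-t"] t1 by (simp add: odd_Q_minus \<epsilon>_def)
        then show ?thesis by simp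
      qed (use Suc.IH[of t] t1 in \<open>simp add: \<epsilon>_def\<close>)
      then have "- \<epsilon> \<le> lam - odd_Q t" using lam_gt_1 by simp
      from divide_right_mono[OF this, of "lam ^ a"] show ?thesis using lam_pos by simp
    qed
    finally have lower: "-(\<epsilon> / lam) \<le> odd_Q x" by (simp add: eq)
    have upper: "odd_Q x \<le> 1 + \<epsilon> / lam"
    proof (cases "t \<ge> 0")
      case True
      then have "lam - odd_Q t \<le> lam + \<epsilon>" using Suc.IH[of t] t1 by (simp add: \<epsilon>_def)
      then have "odd_Q x \<le> (lam + \<epsilon>) / lam ^ a"
        unfolding eq using lam_pos by (intro divide_right_mono) auto
      also have "\<dots> \<le> (lam + \<epsilon>) / lam ^ 1" using \<epsilon> lam_pos a1 by (intro divide_lam_power_le) auto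
      finally show ?thesis using lam_pos by (simp add: add_divide_distrib)
    next
      case False
      have "a \<noteq> 1" using quot_plus_rem_ge_1[OF x(2)] Suc.prems False by (auto simp: a_def t_def)
      then have "3 \<le> a" using odd_quot[OF x(2)] unfolding a_def by presburger
      have "lam - odd_Q t \<le> (lam + 1) + \<epsilon>"
        using Suc.IH[of "-t"] t1 False by (simp add: odd_Q_minus \<epsilon>_def)
      then have "odd_Q x \<le> ((lam + 1) + \<epsilon>) / lam ^ a"
        unfolding eq using lam_pos by (intro divide_right_mono) auto
      also have "\<dots> = (lam + 1) / lam ^ a + \<epsilon> / lam ^ a" by (rule add_divide_distrib)
      also have "\<dots> \<le> (lam + 1) / lam ^ (1 + 2) + \<epsilon> / lam ^ 1"
        using \<epsilon> lam_pos \<open>3 \<le> a\<close> by (intro add_mono divide_lam_power_le) auto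
      also have "\<dots> \<le> 1 + \<epsilon> / lam" unfolding lam_step using lam_pos by simp
      finally show ?thesis .
    qed
    show ?thesis unfolding \<epsilon>' using lower upper by auto
  qed (use \<epsilon> lam_pos \<epsilon>' in auto)
qed

lemma div_lam_power_tendsto_0: "(\<lambda>n. B / lam ^ n) \<longlonglongrightarrow> 0"
proof -
  have "(\<lambda>n. B * (1 / lam) ^ n) \<longlonglongrightarrow> 0"
    using lam_gt_1 by (intro tendsto_mult_right_zero LIMSEQ_power_zero) auto
  then show ?thesis by (simp add: power_divide)
qed

lemma odd_Q_range:
  assumes "x \<in> {0..1}"
  shows "odd_Q x \<in> {0..1}"
proof -
  obtain B where B: "B \<ge> 0" "\<And>x. \<bar>odd_Q x\<bar> \<le> B" using odd_Q_bounded by blast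
  note range = odd_Q_approx_range[OF B assms]
  have lim: "(\<lambda>n. - (B / lam ^ n)) \<longlonglongrightarrow> 0" "(\<lambda>n. 1 + B / lam ^ n) \<longlonglongrightarrow> 1"
    using tendsto_minus[OF div_lam_power_tendsto_0] tendsto_add[OF tendsto_const div_lam_power_tendsto_0, of 1]
    by auto
  show ?thesis
    using LIMSEQ_le_const2[OF lim(1), of "odd_Q x"] LIMSEQ_le_const[OF lim(2), of "odd_Q x"] range
    by auto
qed

lemma abs_odd_Q_le_1: "\<bar>x\<bar> \<le> 1 \<Longrightarrow> \<bar>odd_Q x\<bar> \<le> 1"
  using odd_Q_range[of x] odd_Q_range[of "-x"] by (cases "x \<ge> 0") (auto simp: odd_Q_minus)

lemma odd_Q_gt_0: "x > 0 \<Longrightarrow> odd_Q x > 0"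
  using odd_Q_pos[of x] abs_odd_Q_le_1[OF abs_rem_le_1, of x] lam_gt_1 by auto

lemma odd_Q_eq_0: "odd_Q x = 0 \<Longrightarrow> x = 0"
  using odd_Q_gt_0[of x] odd_Q_gt_0[of "-x"] by (cases "x = 0") (auto simp: odd_Q_minus neq_iff)

lemma odd_Q_less_1:
  assumes "0 < x" "x < 1"
  shows "odd_Q x < 1"
proof (cases "quot x = 1")
  case True
  have "1 / x > 1" using assms by simp
  moreover have "1 + rem x = 1 / x" using True quot_plus_rem[of x] assms by simp
  ultimately have "rem x > 0" by linarith
  then show ?thesis using odd_Q_pos[OF assms(1)] odd_Q_gt_0[of "rem x"] True lam_pos by simp
next
  case False
  have "odd (quot x)" using assms by (intro odd_quot) auto
  with False have q: "1 < quot x" by presburger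
  have "odd_Q x \<le> (lam + 1) / lam ^ quot x"
    using abs_odd_Q_le_1[OF abs_rem_le_1, of x] lam_pos
    unfolding odd_Q_pos[OF assms(1)] by (intro divide_right_mono) auto
  also have "\<dots> \<le> (lam - 1) / lam ^ 1" using lam_branch_le[OF \<open>odd (quot x)\<close> _ q] by simp
  also have "\<dots> < 1" using lam_pos by simp
  finally show ?thesis .
qed

lemma odd_Q_gt_minus_1:
  assumes "-1 < x" "x \<le> 1"
  shows "odd_Q x > -1"
proof (cases "x < 0")
  case True
  with odd_Q_less_1[of "-x"] assms show ?thesis by (simp add: odd_Q_minus)
next
  case False
  with odd_Q_range[of x] assms show ?thesis by auto
qed

text \<open>
  A symmetric way to say that \<open>odd_Q\<close> fails to be strictly increasing on the pair; the symmetry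
  absorbs the reversal of order in \<open>x \<mapsto> 1 / x\<close>.
\<close>

definition inverts :: "real \<Rightarrow> real \<Rightarrow> bool" where
  "inverts u v \<longleftrightarrow> u \<noteq> v \<and> (u - v) * (odd_Q u - odd_Q v) \<le> 0"

lemma inverts_less: "u < v \<Longrightarrow> inverts u v \<longleftrightarrow> odd_Q v \<le> odd_Q u"
  by (auto simp: inverts_def mult_le_0_iff)

lemma inverts_sym: "inverts u v \<longleftrightarrow> inverts v u"
  by (auto simp: inverts_def algebra_simps)

text \<open>
  If the digits differed, \<open>lam_branch_le\<close> would put the two values into the right order, strictly
  because a remainder is never \<open>-1\<close>. With equal digits, both \<open>x \<mapsto> rem x\<close> and the corresponding branch
  in the image reverse the order.
\<close>

lemma inverts_pos:
  assumes "0 < u" "u < v" "odd_Q v \<le> odd_Q u"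
  shows "quot u = quot v \<and> inverts (rem u) (rem v)"
proof -
  have odd: "odd (quot u)" "odd (quot v)" using assms odd_quot[of u] odd_quot[of v] by auto
  have gt: "quot u + rem u > quot v + rem v"
    using assms unfolding quot_plus_rem by (simp add: field_simps)
  have "\<not> quot u < quot v"
  proof
    assume "quot u < quot v"
    with odd have "quot u + 2 \<le> quot v" by presburger
    with gt rem_bounds[of u] rem_bounds[of v] show False by linarith
  qed
  moreover have "\<not> quot v < quot u"
  proof
    assume less: "quot v < quot u"
    have "odd_Q u < (lam + 1) / lam ^ quot u"
      using assms odd_Q_gt_minus_1[OF rem_bounds, of u] lam_pos
      by (simp add: odd_Q_pos divide_strict_right_mono)
    also have "\<dots> \<le> (lam - 1) / lam ^ quot v" using lam_branch_le[OF odd less] .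
    also have "\<dots> \<le> odd_Q v"
      using assms abs_odd_Q_le_1[OF abs_rem_le_1, of v] lam_pos
      by (simp add: odd_Q_pos divide_right_mono)
    finally show False using assms by simp
  qed
  ultimately have eq: "quot u = quot v" by simp
  with gt have less: "rem v < rem u" by simp
  have "odd_Q (rem u) \<le> odd_Q (rem v)"
    using assms eq lam_pos by (simp add: odd_Q_pos divide_le_cancel)
  with eq inverts_less[OF less] inverts_sym show ?thesis by blast
qed

lemma inverts_rem:
  assumes "inverts u v"
  shows "u \<noteq> 0" "v \<noteq> 0" "digit u = digit v" "inverts (rem u) (rem v)"
proof -
  have *: "u \<noteq> 0 \<and> v \<noteq> 0 \<and> digit u = digit v \<and> inverts (rem u) (rem v)"
    if "u < v" "odd_Q v \<le> odd_Q u" for u v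
  proof (cases "u > 0")
    case True
    with inverts_pos[OF _ that] that show ?thesis by (auto simp: digit_def)
  next
    case u: False
    show ?thesis
    proof (cases "v < 0")
      case True
      with inverts_pos[of "-v" "-u"] that show ?thesis
        by (auto simp: digit_def odd_Q_minus inverts_sym)
    next
      case False
      have "odd_Q u \<le> 0" "odd_Q v \<ge> 0" using u False odd_Q_gt_0[of "-u"] odd_Q_gt_0[of v]
        by (auto simp: odd_Q_minus le_less not_less)
      with that have "odd_Q u = 0" "odd_Q v = 0" by auto
      with that odd_Q_eq_0 show ?thesis by blast
    qed
  qed
  have "u < v \<or> v < u" using assms by (auto simp: inverts_def)
  then have "u \<noteq> 0 \<and> v \<noteq> 0 \<and> digit u = digit v \<and> inverts (rem u) (rem v)"
  proof
    assume "v < u"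
    with *[of v u] assms show ?thesis using inverts_less inverts_sym by metis
  qed (use * assms inverts_less in auto)
  then show "u \<noteq> 0" "v \<noteq> 0" "digit u = digit v" "inverts (rem u) (rem v)" by auto
qed

lemma odd_Q_strict_mono:
  assumes "-1 \<le> u" "u < v" "v \<le> 1"
  shows "odd_Q u < odd_Q v"
proof (rule ccontr)
  assume "\<not> odd_Q u < odd_Q v"
  then have "inverts u v" using assms inverts_less by auto
  then have inv: "inverts ((rem ^^ n) u) ((rem ^^ n) v)" for n
    by (induction n) (auto intro: inverts_rem)
  have "u = v" using inverts_rem[OF inv] assms by (intro digits_determine) auto
  with assms show False by simp
qed

text \<open>
  The powers of \<open>lam\<^sup>2\<close> locate \<open>y\<close> between \<open>1 / lam ^ (2 * m + 2)\<close> and \<open>1 / lam ^ (2 * m)\<close>. This interval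
  is shared by the positive half of the branch \<open>2 * m + 1\<close> and the negative half of the branch
  \<open>2 * m + 3\<close>.
\<close>

lemma lam_branch_cover:
  assumes "0 < y" "y \<le> 1"
  obtains a s where "odd a" "\<bar>s\<bar> \<le> 1" "a = 1 \<Longrightarrow> s \<ge> 0" "y = (lam - s) / lam ^ a"
proof -
  define P where "P m \<longleftrightarrow> 1 / lam ^ (2 * m + 2) < y" for m
  have "\<exists>m. P m"
  proof -
    have "(\<lambda>m. 1 / lam ^ (2 * m + 2)) \<longlonglongrightarrow> 0"
      by (rule filterlim_compose[OF div_lam_power_tendsto_0])
        (auto intro!: filterlim_subseq strict_monoI)
    from order_tendstoD(2)[OF this assms(1)] show ?thesis
      unfolding P_def by (auto simp: eventually_sequentially)
  qed
  define m where "m = (LEAST m. P m)"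
  have low: "1 / lam ^ (2 * m + 2) < y"
    using LeastI_ex[OF \<open>\<exists>m. P m\<close>] unfolding m_def P_def .
  have up: "y \<le> 1 / lam ^ (2 * m)"
  proof (cases m)
    case (Suc k)
    then have "\<not> P k" unfolding m_def using not_less_Least[of k P] by simp
    then show ?thesis unfolding P_def Suc by simp
  qed (use assms in simp)
  define z where "z = lam ^ (2 * m + 1) * y"
  have z: "1 / lam < z" "z \<le> lam" and y: "y = z / lam ^ (2 * m + 1)"
    using low up lam_pos unfolding z_def by (auto simp: field_simps)
  show ?thesis
  proof (cases "z \<ge> lam - 1")
    case True
    show ?thesis by (rule that[of "2 * m + 1" "lam - z"]) (use True z y in auto)
  next
    case False
    have "lam ^ 2 * z \<le> lam ^ 2 * (lam - 1)" using False by (intro mult_left_mono) auto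
    then have "lam ^ 2 * z \<le> lam + 1" using lam_plus_1 by simp
    moreover have "lam < lam ^ 2 * z" using z lam_pos by (simp add: field_simps power2_eq_square)
    moreover have "y = lam ^ 2 * z / lam ^ (2 * m + 3)"
      using y lam_pos by (simp add: eval_nat_numeral)
    ultimately show ?thesis by (intro that[of "2 * m + 3" "lam - lam ^ 2 * z"]) auto
  qed
qed

text \<open>
  An approximation of \<open>s\<close> is carried to one of \<open>y = (lam - s) / lam ^ a\<close> by the functional equation, and
  the error shrinks by the factor \<open>lam ^ a\<close>. Here the case \<open>t = -1\<close> of \<open>odd_Q_inverse\<close> may occur.
\<close>

lemma odd_Q_dense_approx:
  "y \<in> {0..1} \<Longrightarrow> \<exists>x\<in>{0..1}. \<bar>odd_Q x - y\<bar> \<le> 1 / lam ^ n"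
proof (induction n arbitrary: y)
  case 0
  then show ?case by (intro bexI[of _ 0]) auto
next
  case (Suc n)
  show ?case
  proof (cases "y = 0")
    case False
    then have y: "y > 0" "y \<le> 1" using Suc.prems by auto
    obtain a s where as: "odd a" "\<bar>s\<bar> \<le> 1" "a = 1 \<Longrightarrow> s \<ge> 0" "y = (lam - s) / lam ^ a"
      using lam_branch_cover[OF y] by blast
    have a1: "1 \<le> a" using as(1) by (cases a) auto
    obtain u where u: "u \<in> {0..1}" "\<bar>odd_Q u - \<bar>s\<bar>\<bar> \<le> 1 / lam ^ n"
      using Suc.IH[of "\<bar>s\<bar>"] as by auto
    define t where "t = (if s \<ge> 0 then u else - u)"
    have t: "\<bar>t\<bar> \<le> 1" "\<bar>odd_Q t - s\<bar> \<le> 1 / lam ^ n" "a = 1 \<Longrightarrow> t \<ge> 0"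
      using u as(3) by (auto simp: t_def odd_Q_minus)
    have at: "real a + t \<ge> 1"
    proof (cases "a = 1")
      case False
      with as(1) have "a \<ge> 3" by presburger
      with t show ?thesis by linarith
    qed (use t in auto)
    have "odd_Q (1 / (real a + t)) - y = (s - odd_Q t) / lam ^ a"
      unfolding odd_Q_inverse[OF as(1) t(1) at] as(4) by (simp add: diff_divide_distrib)
    then have "\<bar>odd_Q (1 / (real a + t)) - y\<bar> = \<bar>odd_Q t - s\<bar> / lam ^ a"
      using lam_pos by (simp add: abs_minus_commute)
    also have "\<dots> \<le> (1 / lam ^ n) / lam ^ 1"
      using t(2) a1 lam_pos lam_gt_1 by (intro frac_le power_increasing) auto
    finally show ?thesis using at by (intro bexI[of _ "1 / (real a + t)"]) (auto simp: mult.commute)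
  qed (use lam_pos in \<open>auto intro!: bexI[of _ 0]\<close>)
qed

text \<open>Jumps are the only discontinuities of a monotone function, and a jump leaves a gap in the values.\<close>

lemma strict_mono_on_dense_continuous:
  fixes f :: "real \<Rightarrow> real"
  assumes mono: "\<And>x y. a \<le> x \<Longrightarrow> x < y \<Longrightarrow> y \<le> b \<Longrightarrow> f x < f y"
    and dense: "\<And>c d. f a \<le> c \<Longrightarrow> c < d \<Longrightarrow> d \<le> f b \<Longrightarrow> \<exists>x\<in>{a..b}. c < f x \<and> f x < d"
  shows "continuous_on {a..b} f"
  unfolding continuous_on_def
proof (intro ballI order_tendstoI)
  fix x c assume x: "x \<in> {a..b}" and c: "c < f x"
  show "\<forall>\<^sub>F y in at x within {a..b}. c < f y"
  proof (cases "c < f a")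
    case True
    have "f a \<le> f y" if "y \<in> {a..b}" for y using mono[of a y] that by (cases "a = y") auto
    with True have "c < f y" if "y \<in> {a..b}" for y using that by force
    then show ?thesis by (simp add: eventually_at_filter)
  next
    case False
    have "f x \<le> f b" using mono[of x b] x by (cases "x = b") auto
    then obtain u where u: "u \<in> {a..b}" "c < f u" "f u < f x" using dense[of c "f x"] False c by auto
    have "u < x" using mono[of x u] u x by (cases x u rule: linorder_cases) auto
    have "c < f y" if "y \<in> {a..b}" "u < y" for y using mono[of u y] that u by auto
    moreover have "\<forall>\<^sub>F y in at x within {a..b}. u < y"
      by (rule order_tendstoD(1)[OF tendsto_ident_at \<open>u < x\<close>])
    moreover have "\<forall>\<^sub>F y in at x within {a..b}. y \<in> {a..b}" by (simp add: eventually_at_filter)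
    ultimately show ?thesis by (auto elim: eventually_elim2)
  qed
next
  fix x c assume x: "x \<in> {a..b}" and c: "f x < c"
  show "\<forall>\<^sub>F y in at x within {a..b}. f y < c"
  proof (cases "f b < c")
    case True
    have "f y \<le> f b" if "y \<in> {a..b}" for y using mono[of y b] that by (cases "y = b") auto
    with True have "f y < c" if "y \<in> {a..b}" for y using that by force
    then show ?thesis by (simp add: eventually_at_filter)
  next
    case False
    have "f a \<le> f x" using mono[of a x] x by (cases "x = a") auto
    then obtain u where u: "u \<in> {a..b}" "f x < f u" "f u < c" using dense[of "f x" c] False c by auto
    have "x < u" using mono[of u x] u x by (cases x u rule: linorder_cases) auto
    have "f y < c" if "y \<in> {a..b}" "y < u" for y using mono[of y u] that u by auto
    moreover have "\<forall>\<^sub>F y in at x within {a..b}. y < u"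
      by (rule order_tendstoD(2)[OF tendsto_ident_at \<open>x < u\<close>])
    moreover have "\<forall>\<^sub>F y in at x within {a..b}. y \<in> {a..b}" by (simp add: eventually_at_filter)
    ultimately show ?thesis by (auto elim: eventually_elim2)
  qed
qed

lemma odd_Q_continuous: "continuous_on {0..1} odd_Q"
proof (rule strict_mono_on_dense_continuous)
  fix c d assume cd: "odd_Q 0 \<le> c" "c < d" "d \<le> odd_Q 1"
  obtain n where "1 / lam ^ n < (d - c) / 2"
    using order_tendstoD(2)[OF div_lam_power_tendsto_0[of 1], of "(d - c) / 2"] cd
    by (auto simp: eventually_sequentially)
  moreover obtain x where "x \<in> {0..1}" "\<bar>odd_Q x - (c + d) / 2\<bar> \<le> 1 / lam ^ n"
    using odd_Q_dense_approx[of "(c + d) / 2" n] cd by auto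
  ultimately have "x \<in> {0..1}" "\<bar>odd_Q x - (c + d) / 2\<bar> < (d - c) / 2" by auto
  then show "\<exists>x\<in>{0..1}. c < odd_Q x \<and> odd_Q x < d"
    by (intro bexI[of _ x]) (auto simp: abs_less_iff field_simps)
qed (auto intro: odd_Q_strict_mono)

lemma Q_O_continuous: "continuous_on {0..1} Q_O"
  using odd_Q_continuous by (rule continuous_on_eq) (simp add: Q_O_eq_odd_Q)

lemma Q_O_inj: "inj_on Q_O {0..1}"
proof (rule linorder_inj_onI)
  fix x y :: real assume "x < y" "x \<in> {0..1}" "y \<in> {0..1}"
  then show "Q_O x \<noteq> Q_O y" using odd_Q_strict_mono[of x y] by (simp add: Q_O_eq_odd_Q)
qed auto

lemma Q_O_image: "Q_O ` {0..1} = {0..1}"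
proof
  show "Q_O ` {0..1} \<subseteq> {0..1}" using odd_Q_range by (auto simp: Q_O_eq_odd_Q)
  show "{0..1} \<subseteq> Q_O ` {0..1}"
  proof
    fix y :: real assume "y \<in> {0..1}"
    then have "\<exists>x\<ge>0. x \<le> 1 \<and> odd_Q x = y"
      by (intro IVT' odd_Q_continuous) auto
    then show "y \<in> Q_O ` {0..1}" by (force simp: Q_O_eq_odd_Q)
  qed
qed

lemma Q_O_homeomorphism: "homeomorphism {0..1} {0..1} Q_O Q_O_inv"
proof -
  have left: "Q_O_inv (Q_O x) = x" if "x \<in> {0..1}" for x
    unfolding Q_O_inv_def using Q_O_inj that by (rule inv_into_f_f)
  have "continuous_on (Q_O ` {0..1}) Q_O_inv"
    using left by (intro continuous_on_inv Q_O_continuous) auto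
  then have cont: "continuous_on {0..1} Q_O_inv" by (simp only: Q_O_image)
  have right: "Q_O_inv y \<in> {0..1} \<and> Q_O (Q_O_inv y) = y" if "y \<in> {0..1}" for y
  proof -
    have y: "y \<in> Q_O ` {0..1}" using that by (simp only: Q_O_image)
    show ?thesis unfolding Q_O_inv_def using inv_into_into[OF y] f_inv_into_f[OF y] by blast
  qed
  show ?thesis
    using left right Q_O_image by (intro homeomorphismI Q_O_continuous cont) auto
qed

section \<open>The conjugacies\<close>

lemma Q_O_F_O:
  assumes "x \<in> {0..1}"
  shows "Q_O (F_O x) = F_O_bar (Q_O x)"
proof -
  have third: "odd_Q (1/3) = 1 / lam ^ 2"
    using odd_Q_inverse[of 3 0] lam_pos by (simp add: power2_eq_square power3_eq_cube)
  have half: "odd_Q (1/2) = 1 - 1 / lam"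
    using odd_Q_inverse[of 1 1] lam_pos by (simp add: diff_divide_distrib)
  have less: "odd_Q u < odd_Q v \<longleftrightarrow> u < v" if "u \<in> {0..1}" "v \<in> {0..1}" for u v
    using odd_Q_strict_mono[of u v] odd_Q_strict_mono[of v u] that by (cases u v rule: linorder_cases) auto
  consider "x = 0" | "0 < x" "x < 1/3" | "1/3 \<le> x" "x \<le> 1/2" | "1/2 < x" 
    using assms by force
  then show ?thesis
  proof cases
    case 1
    then show ?thesis using lam_pos by (simp add: F_O_def F_O_bar_def Q_O_eq_odd_Q)
  next
    case 2
    define a where "a = quot x"
    define t where "t = rem x"
    have at: "odd a" "\<bar>t\<bar> \<le> 1" "real a + t = 1 / x"
      using 2 odd_quot[of x] abs_rem_le_1[of x] quot_plus_rem[of x] by (auto simp: a_def t_def)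
    have "1 / x > 3" using 2 by (simp add: field_simps)
    with at have at3: "real a + t > 3" by simp
    with at have "a > 2" by linarith
    then have a2: "real (a - 2) = real a - 2" "odd (a - 2)" "a = (a - 2) + 2" using at(1) by auto
    have F: "F_O x = 1 / (real (a - 2) + t)"
      using 2 at(3) a2 at3 by (simp add: F_O_def field_simps)
    have "F_O x \<in> {0..1}" unfolding F using at3 a2 by simp
    then have "Q_O (F_O x) = (lam - odd_Q t) / lam ^ (a - 2)"
      using odd_Q_inverse[OF a2(2) at(2)] at3 a2 F by (simp add: Q_O_eq_odd_Q)
    also have "\<dots> = lam ^ 2 * ((lam - odd_Q t) / lam ^ a)"
      using lam_pos by (subst (2) a2(3), subst power_add) simp
    also have "(lam - odd_Q t) / lam ^ a = Q_O x"
      using odd_Q_pos[of x] 2 assms by (simp add: Q_O_eq_odd_Q a_def t_def)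
    also have "Q_O x < 1 / lam ^ 2" using less[of x "1/3"] 2 third by (simp add: Q_O_eq_odd_Q)
    then have "lam ^ 2 * Q_O x = F_O_bar (Q_O x)" by (simp add: F_O_bar_def)
    finally show ?thesis .
  next
    case 3
    define t where "t = 1 / x - 3"
    have t: "-1 \<le> t" "t \<le> 0" "x = 1 / (real 3 + t)" using 3 by (auto simp: t_def field_simps)
    have F: "F_O x = - t" using 3 by (simp add: F_O_def t_def)
    have "Q_O x = (lam - odd_Q t) / lam ^ 3"
      using odd_Q_inverse[of 3 t] t assms by (simp add: Q_O_eq_odd_Q)
    then have "lam ^ 3 * Q_O x = lam - odd_Q t" using lam_pos by simp
    moreover have "Q_O (F_O x) = - odd_Q t"
      unfolding F using t by (simp add: Q_O_eq_odd_Q odd_Q_minus)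
    ultimately have "lam * (lam ^ 2 * Q_O x - 1) = Q_O (F_O x)"
      by (simp add: algebra_simps power2_eq_square power3_eq_cube)
    moreover have "\<not> Q_O x < 1 / lam ^ 2" "Q_O x \<le> 1 - 1 / lam"
      using less[of x "1/3"] less[of "1/2" x] 3 third half by (auto simp: Q_O_eq_odd_Q)
    ultimately show ?thesis by (simp add: F_O_bar_def)
  next
    case 4
    define t where "t = 1 / x - 1"
    have t: "0 \<le> t" "t \<le> 1" "x = 1 / (real 1 + t)" using 4 assms by (auto simp: t_def field_simps)
    have F: "F_O x = t" using 4 by (simp add: F_O_def t_def)
    have "Q_O x = (lam - odd_Q t) / lam"
      using odd_Q_inverse[of 1 t] t assms by (simp add: Q_O_eq_odd_Q)
    then have "lam * Q_O x = lam - odd_Q t" using lam_pos by simp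
    moreover have "Q_O (F_O x) = odd_Q t" unfolding F using t by (simp add: Q_O_eq_odd_Q)
    ultimately have "lam * (1 - Q_O x) = Q_O (F_O x)" by (simp add: algebra_simps)
    moreover have "\<not> Q_O x < 1 / lam ^ 2" "\<not> Q_O x \<le> 1 - 1 / lam"
      using less[of "1/3" x] less[of "1/2" x] 4 assms third half by (auto simp: Q_O_eq_odd_Q)
    ultimately show ?thesis by (simp add: F_O_bar_def)
  qed
qed

text \<open>
  If two odd integers are both within distance \<open>1\<close> of \<open>1 / x\<close>, then \<open>1 / x\<close> is their midpoint and both
  distances are \<open>1\<close>. So all branches that apply at a common end point give the same value.
\<close>

lemma T_O_inverse:
  assumes "odd a" "\<bar>t\<bar> \<le> 1" "real a + t \<ge> 1"
  shows "T_O (1 / (real a + t)) = \<bar>t\<bar>"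
proof -
  define x where "x = 1 / (real a + t)"
  have x: "x > 0" "1 / x = real a + t" using assms by (auto simp: x_def)
  have *: "\<bar>1 / x - real b\<bar> = \<bar>t\<bar>" if "odd b" "\<bar>1 / x - real b\<bar> \<le> 1" for b
  proof (cases a b rule: linorder_cases)
    case less
    with that assms have "a + 2 \<le> b" by presburger
    with x that assms show ?thesis by linarith
  next
    case greater
    with that assms have "b + 2 \<le> a" by presburger
    with x that assms show ?thesis by linarith
  qed (use x in simp)
  show ?thesis unfolding x_def[symmetric] T_O_def
  proof (rule the_equality, goal_cases)
    case 1
    obtain m where m: "a = 2 * m + 1" using assms(1) by (auto elim: oddE)
    show ?case
    proof (cases "t \<ge> 0")
      case True
      have "\<exists>k\<ge>1. x \<in> {1 / (2 * real k) .. 1 / (2 * real k - 1)} \<and>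
        \<bar>t\<bar> = 1 / x - (2 * real k - 1)"
        using True assms m x by (intro exI[of _ "Suc m"]) (auto simp: x_def intro!: divide_left_mono)
      then show ?thesis by blast
    next
      case False
      then have "m \<ge> 1" using m assms by (cases m) auto
      then have "\<exists>k\<ge>1. x \<in> {1 / (2 * real k + 1) .. 1 / (2 * real k)} \<and>
        \<bar>t\<bar> = 2 * real k + 1 - 1 / x"
        using False assms m x by (intro exI[of _ m]) (auto simp: x_def intro!: divide_left_mono)
      then show ?thesis by blast
    qed
  next
    case (2 y)
    then consider k :: nat where "k \<ge> 1" "1 / (2 * real k + 1) \<le> x" "x \<le> 1 / (2 * real k)"
        "y = 2 * real k + 1 - 1 / x"
      | k :: nat where "k \<ge> 1" "1 / (2 * real k) \<le> x" "x \<le> 1 / (2 * real k - 1)"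
        "y = 1 / x - (2 * real k - 1)"
      using x by auto
    then show ?case
    proof cases
      case 1
      then have "1 / x \<le> 2 * real k + 1" "2 * real k \<le> 1 / x" using x(1) by (auto simp: field_simps)
      with *[of "2 * k + 1"] 1 show ?thesis by auto
    next
      case 2
      have "2 * real k - 1 > 0" using 2 by simp
      with 2 have "1 / x \<le> 2 * real k" "2 * real k - 1 \<le> 1 / x" using x(1) by (auto simp: field_simps)
      with *[of "2 * k - 1"] 2 show ?thesis by (auto simp: of_nat_diff)
    qed
  qed
qed

text \<open>
  As for \<open>T_O\<close>, a point lying on two branches is a common end point: then \<open>lam_branch_le\<close> holds with
  equality and the parameters are \<open>1\<close> and \<open>-1\<close>, so both branches give \<open>1\<close>.
\<close>

lemma T_O_bar_branch:
  assumes "odd a" "\<bar>s\<bar> \<le> 1" "a = 1 \<Longrightarrow> s \<ge> 0"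
  shows "T_O_bar ((lam - s) / lam ^ a) = \<bar>s\<bar>"
proof -
  define y where "y = (lam - s) / lam ^ a"
  have s: "s = lam - lam ^ a * y" using lam_pos by (simp add: y_def)
  have y: "y > 0" unfolding y_def using assms lam_gt_1 by auto
  have *: "\<bar>s'\<bar> = \<bar>s\<bar>" if "odd b" "\<bar>s'\<bar> \<le> 1" "s' = lam - lam ^ b * y" for b s'
  proof -
    have eq: "(lam - s') / lam ^ b = (lam - s) / lam ^ a"
      using that lam_pos by (simp add: y_def[symmetric])
    have ends: "\<bar>u\<bar> = \<bar>v\<bar>" if "odd c" "odd d" "c < d" "\<bar>u\<bar> \<le> 1" "\<bar>v\<bar> \<le> 1"
      "(lam - u) / lam ^ c = (lam - v) / lam ^ d" for u v c d
    proof -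
      have upper: "(lam - v) / lam ^ d \<le> (lam + 1) / lam ^ d"
        using that lam_pos by (intro divide_right_mono) auto
      have lower: "(lam - 1) / lam ^ c \<le> (lam - u) / lam ^ c"
        using that lam_pos by (intro divide_right_mono) auto
      have le: "(lam + 1) / lam ^ d \<le> (lam - v) / lam ^ d"
        using order_trans[OF lam_branch_le[OF that(2,1,3)] lower] that(6) by (simp only:)
      have "v = -1" using antisym[OF upper le] lam_pos by simp
      moreover have "(lam - u) / lam ^ c \<le> (lam - 1) / lam ^ c"
        unfolding that(6) using order_trans[OF upper lam_branch_le[OF that(2,1,3)]] .
      then have "u = 1" using lower lam_pos by (simp add: divide_le_cancel)
      ultimately show ?thesis by simp
    qed
    show ?thesis
    proof (cases a b rule: linorder_cases)
      case less
      from ends[OF assms(1) that(1) less assms(2) that(2) eq[symmetric]] show ?thesis by simp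
    next
      case equal
      then show ?thesis unfolding s that(3) by simp
    next
      case greater
      from ends[OF that(1) assms(1) greater that(2) assms(2) eq] show ?thesis .
    qed
  qed
  obtain m where m: "a = 2 * m + 1" using assms(1) by (auto elim: oddE)
  show ?thesis unfolding y_def[symmetric] T_O_bar_def
  proof (rule the_equality, goal_cases)
    case 1
    show ?case
    proof (cases "s \<ge> 0")
      case True
      have "\<exists>k\<ge>1. y \<in> {(lam - 1) / lam ^ (2 * k - 1) .. 1 / lam ^ (2 * k - 2)} \<and>
        \<bar>s\<bar> = lam - lam ^ (2 * k - 1) * y"
        using True assms m lam_pos
        by (intro exI[of _ "Suc m"]) (auto simp: y_def field_simps)
      then show ?thesis by blast
    next
      case False
      then obtain n where n: "m = Suc n" using m assms by (cases m) auto
      have "(lam - s) / lam ^ a \<le> (lam + 1) / lam ^ a"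
        using assms lam_pos by (intro divide_right_mono) auto
      also have "\<dots> = (lam - 1) / lam ^ Suc (2 * n)" using lam_step[of "Suc (2 * n)"] m n by simp
      finally have "\<exists>k\<ge>2. y \<in> {1 / lam ^ (2 * k - 2) .. (lam - 1) / lam ^ (2 * k - 3)} \<and>
        \<bar>s\<bar> = lam ^ (2 * k - 1) * y - lam"
        using False assms m lam_pos n
        by (intro exI[of _ "Suc m"]) (auto simp: y_def field_simps eval_nat_numeral)
      then show ?thesis by blast
    qed
  next
    case (2 z)
    then consider k :: nat where "k \<ge> 1" "(lam - 1) / lam ^ (2 * k - 1) \<le> y"
        "y \<le> 1 / lam ^ (2 * k - 2)" "z = lam - lam ^ (2 * k - 1) * y"
      | k :: nat where "k \<ge> 2" "1 / lam ^ (2 * k - 2) \<le> y"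
        "y \<le> (lam - 1) / lam ^ (2 * k - 3)" "z = lam ^ (2 * k - 1) * y - lam"
      using y by auto
    then show ?case
    proof cases
      case 1
      then obtain n where n: "k = Suc n" by (cases k) auto
      have "lam - 1 \<le> lam ^ (2 * k - 1) * y" "lam ^ (2 * k - 1) * y \<le> lam"
        using 1 lam_pos n by (auto simp: field_simps)
      with *[of "2 * k - 1" z] 1 show ?thesis by auto
    next
      case 2
      then obtain n where n: "k = Suc (Suc n)" by (metis Suc_le_D numeral_2_eq_2 Suc_le_mono)
      have "(lam - 1) / lam ^ (2 * k - 3) = (lam + 1) / lam ^ (2 * k - 1)"
        using lam_step[of "2 * k - 3"] n by (simp add: eval_nat_numeral)
      with 2 have "y \<le> (lam + 1) / lam ^ (2 * k - 1)" by simp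
      then have "lam ^ (2 * k - 1) * y \<le> lam + 1"
        using lam_pos by (simp add: pos_le_divide_eq mult.commute)
      moreover have "lam \<le> lam ^ (2 * k - 1) * y" using 2 lam_pos n by (auto simp: field_simps)
      ultimately have "\<bar>-z\<bar> \<le> 1" "odd (2 * k - 1)" "- z = lam - lam ^ (2 * k - 1) * y"
        using 2 by auto
      with *[of "2 * k - 1" "-z"] have "\<bar>-z\<bar> = \<bar>s\<bar>" by blast
      moreover have "z \<ge> 0" using \<open>lam \<le> lam ^ (2 * k - 1) * y\<close> 2 by simp
      ultimately show ?thesis by simp
    qed
  qed
qed

lemma Q_O_T_O:
  assumes "x \<in> {0..1}"
  shows "Q_O (T_O x) = T_O_bar (Q_O x)"
proof (cases "x = 0")
  case True
  have "T_O 0 = 0" unfolding T_O_def by (rule the_equality) auto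
  moreover have "\<not> lam ^ k \<le> 0" for k using lam_pos by (simp add: not_le)
  then have "T_O_bar 0 = 0" unfolding T_O_bar_def
    using lam_gt_1 by (intro the_equality) (auto simp: divide_le_0_iff)
  ultimately show ?thesis using True by (simp add: Q_O_eq_odd_Q)
next
  case False
  then have x: "x > 0" using assms by simp
  define a where "a = quot x"
  define t where "t = rem x"
  have at: "odd a" "\<bar>t\<bar> \<le> 1" "real a + t \<ge> 1"
    using False odd_quot[of x] abs_rem_le_1[of x] quot_plus_rem_ge_1[of x] assms
    by (auto simp: a_def t_def)
  have x_eq: "x = 1 / (real a + t)" using x by (simp add: a_def t_def quot_plus_rem)
  have "a = 1 \<Longrightarrow> odd_Q t \<ge> 0" using at odd_Q_range[of t] by auto
  then have "T_O_bar (Q_O x) = \<bar>odd_Q t\<bar>"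
    using T_O_bar_branch[OF at(1) abs_odd_Q_le_1[OF at(2)]] odd_Q_inverse[OF at] assms x_eq
    by (simp add: Q_O_eq_odd_Q)
  also have "\<dots> = odd_Q \<bar>t\<bar>"
    using at odd_Q_range[of t] odd_Q_range[of "-t"] by (auto simp: odd_Q_minus abs_if)
  also have "\<dots> = Q_O (T_O x)" using at T_O_inverse[OF at] x_eq by (simp add: Q_O_eq_odd_Q)
  finally show ?thesis by simp
qed

theorem proposition10:
  shows "homeomorphism {0..1} {0..1} Q_O Q_O_inv
    \<and> (\<forall>y\<in>{0..1}. (Q_O \<circ> F_O \<circ> Q_O_inv) y = F_O_bar y)
    \<and> (\<forall>y\<in>{0..1}. (Q_O \<circ> T_O \<circ> Q_O_inv) y = T_O_bar y)"
proof (intro conjI ballI)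
  show hom: "homeomorphism {0..1} {0..1} Q_O Q_O_inv" by (rule Q_O_homeomorphism)
  fix y :: real assume y: "y \<in> {0..1}"
  have x: "Q_O_inv y \<in> {0..1}" "Q_O (Q_O_inv y) = y"
    using homeomorphism_image2[OF hom] homeomorphism_apply2[OF hom y] y by blast+
  show "(Q_O \<circ> F_O \<circ> Q_O_inv) y = F_O_bar y" using Q_O_F_O[OF x(1)] x(2) by simp
  show "(Q_O \<circ> T_O \<circ> Q_O_inv) y = T_O_bar y" using Q_O_T_O[OF x(1)] x(2) by simp
qed

end
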